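(* Let $G$ be a connected graph on $n\geq 2$ vertices, and let $0=\partial_1^{\mathcal{L}}\leq \partial_2^{\mathcal{L}}\leq\cdots\leq\partial_n^{\mathcal{L}}$ be the eigenvalues of its normalized distance Laplacian $\mathcal{D}^{\mathcal{L}}(G)$. Then $\partial_2^{\mathcal{L}}=\frac{n}{n-1}$ and $\partial_n^{\mathcal{L}}=\frac{n}{n-1}$ if and only if $G$ is the complete graph $K_n$.
   Context: For a connected graph $G$ with vertices $v_1,\dots,v_n$, $d(v_i,v_j)$ is the graph distance, $\mathcal{D}(G)$ is the distance matrix with entries $d(v_i,v_j)$, the transmission of $v_i$ is $t(v_i)=\sum_{j\neq i} d(v_i,v_j)$, and $T(G)$ is the diagonal matrix with $T_{ii}=t(v_i)$. The normalized distance Laplacian is $\mathcal{D}^{\mathcal{L}}(G)=T^{-1/2}(T-\mathcal{D})T^{-1/2}$, i.e. the matrix with diagonal entries $1$ and off-diagonal entries $-\frac{d(v_i,v_j)}{\sqrt{t(v_i)t(v_j)}}$. Its eigenvalues are denoted $\partial_1^{\mathcal{L}}\leq\cdots\leq\partial_n^{\mathcal{L}}$. *)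

theory Defs
  imports "Graph_Theory.Graph_Theory" "Jordan_Normal_Form.Char_Poly"
begin

text \<open>
  Graphs are finite simple undirected graphs in the sense of the locale \<^locale>\<open>graph\<close>
  (symmetric, loop-free digraphs without parallel arcs). The matrices depend on an enumeration
  \<open>vs\<close> of the vertices, given as a distinct list with \<^prop>\<open>set vs = verts G\<close>.
\<close>

definition gdist :: "('a, 'b) pre_digraph \<Rightarrow> 'a \<Rightarrow> 'a \<Rightarrow> nat" where
  "gdist G u v = (LEAST k. \<exists>p. pre_digraph.awalk G u p v \<and> length p = k)"

definition transmission :: "('a, 'b) pre_digraph \<Rightarrow> 'a \<Rightarrow> nat" where
  "transmission G u = (\<Sum>v \<in> verts G - {u}. gdist G u v)"

definition distance_matrix :: "('a, 'b) pre_digraph \<Rightarrow> 'a list \<Rightarrow> real mat" where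
  "distance_matrix G vs =
     mat (length vs) (length vs) (\<lambda>(i, j). real (gdist G (vs ! i) (vs ! j)))"

definition transmission_matrix :: "('a, 'b) pre_digraph \<Rightarrow> 'a list \<Rightarrow> real mat" where
  "transmission_matrix G vs = mat_diag (length vs) (\<lambda>i. real (transmission G (vs ! i)))"

definition transmission_matrix_inv_sqrt :: "('a, 'b) pre_digraph \<Rightarrow> 'a list \<Rightarrow> real mat" where
  "transmission_matrix_inv_sqrt G vs =
     mat_diag (length vs) (\<lambda>i. 1 / sqrt (real (transmission G (vs ! i))))"

definition normalized_distance_laplacian :: "('a, 'b) pre_digraph \<Rightarrow> 'a list \<Rightarrow> real mat" where
  "normalized_distance_laplacian G vs =
     transmission_matrix_inv_sqrt G vs * (transmission_matrix G vs - distance_matrix G vs)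
       * transmission_matrix_inv_sqrt G vs"

text \<open>
  The real eigenvalues in ascending order, repeated according to algebraic multiplicity.
  For a symmetric matrix all roots of the characteristic polynomial are real, so for an
  \<open>n \<times> n\<close> symmetric matrix this list has length \<open>n\<close>.
\<close>

definition sorted_eigenvalues :: "real mat \<Rightarrow> real list" where
  "sorted_eigenvalues A = sorted_list_of_multiset (proots (char_poly A))"

text \<open>Indexing starts at 1: \<open>nth_eigenvalue A 1\<close> is the smallest eigenvalue.\<close>

definition nth_eigenvalue :: "real mat \<Rightarrow> nat \<Rightarrow> real" where
  "nth_eigenvalue A k = sorted_eigenvalues A ! (k - 1)"

end

theory Submission
  imports Defs "Jordan_Normal_Form.Schur_Decomposition"
begin

text \<open>
  Write \<open>L\<close> for the normalized distance Laplacian, \<open>c = n / (n - 1)\<close>, and \<open>q\<close> for the unit vector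
  proportional to \<open>T\<^sup>1\<^sup>/\<^sup>2 1\<close>, so that \<open>L q = 0\<close>. Since \<open>L\<close> is symmetric with trace \<open>n\<close> and has \<open>0\<close> as an
  eigenvalue, the other \<open>n - 1\<close> eigenvalues have mean \<open>c\<close>; hence they are all equal to \<open>c\<close> iff the
  sum of their squares, which is the trace of \<open>L\<^sup>2\<close>, is \<open>(n - 1) c\<^sup>2\<close>. Expanding the squared Frobenius norm of
  \<open>L - c (I - q q\<^sup>T)\<close> gives exactly the trace of \<open>L\<^sup>2\<close> minus \<open>(n - 1) c\<^sup>2\<close>, so the condition means
  \<open>L = c (I - q q\<^sup>T)\<close>. The diagonal of this identity says that all transmissions agree, and the
  off-diagonal entries then say that all distances between distinct vertices agree. As a connected
  graph has two adjacent vertices, the common distance is 1.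
\<close>

section \<open>Traces under similarity\<close>

definition mat_trace :: "'a :: comm_monoid_add mat \<Rightarrow> 'a" where
  "mat_trace A = (\<Sum>i<dim_row A. A $$ (i, i))"

lemma mat_trace_mult:
  assumes "A \<in> carrier_mat n m" "B \<in> carrier_mat m n"
  shows "mat_trace (A * B) = (\<Sum>i<n. \<Sum>j<m. A $$ (i, j) * B $$ (j, i))"
  using assms by (auto simp: mat_trace_def scalar_prod_def atLeast0LessThan intro!: sum.cong)

lemma mat_trace_mult_commute:
  fixes A :: "'a :: comm_semiring_0 mat"
  assumes "A \<in> carrier_mat n m" "B \<in> carrier_mat m n"
  shows "mat_trace (A * B) = mat_trace (B * A)"
proof -
  have "mat_trace (A * B) = (\<Sum>j<m. \<Sum>i<n. A $$ (i, j) * B $$ (j, i))"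
    unfolding mat_trace_mult[OF assms] by (rule sum.swap)
  then show ?thesis
    unfolding mat_trace_mult[OF assms(2,1)] by (simp add: mult.commute)
qed

lemma mat_trace_similar:
  fixes A :: "'a :: comm_ring_1 mat"
  assumes "similar_mat A B"
  shows "mat_trace A = mat_trace B"
proof -
  from similar_matD[OF assms] obtain n P Q where
    carr: "{A, B, P, Q} \<subseteq> carrier_mat n n" and QP: "Q * P = 1\<^sub>m n" and AB: "A = P * B * Q"
    by auto
  from carr have [simp]: "P \<in> carrier_mat n n" "B \<in> carrier_mat n n" "Q \<in> carrier_mat n n"
    by auto
  have "mat_trace A = mat_trace (P * (B * Q))"
    unfolding AB by (simp add: assoc_mult_mat[of _ n n _ n _ n] mult_carrier_mat[of _ n n _ n])
  also have "\<dots> = mat_trace (B * Q * P)"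
    by (rule mat_trace_mult_commute[of _ n n]) (auto intro!: mult_carrier_mat[of _ n n _ n])
  also have "B * Q * P = B"
    by (simp add: assoc_mult_mat[of _ n n _ n _ n] mult_carrier_mat[of _ n n _ n] QP right_mult_one_mat[of _ n n])
  finally show ?thesis .
qed

text \<open>The inner \<open>Q * P\<close> cancels, so the same pair of matrices conjugates the
  squares. This lets the trace of \<open>A * A\<close> be read off a triangular form of
  \<open>A\<close>.\<close>

lemma similar_mat_square:
  fixes A :: "'a :: comm_ring_1 mat"
  assumes "similar_mat A B"
  shows "similar_mat (A * A) (B * B)"
proof -
  from similar_matD[OF assms] obtain n P Q where
    carr: "{A, B, P, Q} \<subseteq> carrier_mat n n" and PQ: "P * Q = 1\<^sub>m n" and QP: "Q * P = 1\<^sub>m n"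
      and AB: "A = P * B * Q"
    by auto
  from carr have [simp]: "P \<in> carrier_mat n n" "B \<in> carrier_mat n n" "Q \<in> carrier_mat n n"
    by auto
  have "A * A = P * B * (Q * P) * (B * Q)"
    unfolding AB by (simp add: assoc_mult_mat[of _ n n _ n _ n] mult_carrier_mat[of _ n n _ n])
  also have "\<dots> = P * (B * B) * Q"
    unfolding QP by (simp add: left_mult_one_mat[of _ n n] assoc_mult_mat[of _ n n _ n _ n] mult_carrier_mat[of _ n n _ n])
  finally show ?thesis
    using carr PQ QP
    by (intro similar_matI[of _ _ P Q n]) (auto intro!: mult_carrier_mat[of _ n n _ n])
qed

section \<open>Spectra of real symmetric matrices\<close>

text \<open>Pair the image of an eigenvector \<open>v\<close> with the conjugate of \<open>v\<close>
  and move the real symmetric matrix to the other factor: the squared norm of \<open>v\<close>,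
  which is nonzero, is multiplied by \<open>k\<close> on one side and by its conjugate on the
  other.\<close>

lemma eigenvalue_real_symmetric_is_real:
  fixes A :: "real mat"
  assumes A: "A \<in> carrier_mat n n" and sym: "A\<^sup>T = A"
    and ev: "eigenvalue (map_mat complex_of_real A) k"
  shows "k \<in> \<real>"
proof -
  let ?A = "map_mat complex_of_real A"
  have cA: "?A \<in> carrier_mat n n" using A by auto
  have symc: "?A\<^sup>T = ?A" by (simp add: sym map_mat_transpose)
  from ev obtain v where v: "v \<in> carrier_vec n" "v \<noteq> 0\<^sub>v n" and Av: "?A *\<^sub>v v = k \<cdot>\<^sub>v v"
    unfolding eigenvalue_def eigenvector_def using A by auto
  have conjA: "conjugate (?A *\<^sub>v v) = ?A *\<^sub>v conjugate v"
    using A v(1) by (intro eq_vecI) (auto simp: scalar_prod_def sum_conjugate)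
  have "k * (v \<bullet>c v) = (?A *\<^sub>v v) \<bullet>c v"
    using v by (simp add: Av)
  also have "\<dots> = v \<bullet> (?A *\<^sub>v conjugate v)"
    using transpose_vec_mult_scalar[OF cA, of "conjugate v" v] v(1) symc
    by (metis carrier_vec_conjugate)
  also have "\<dots> = v \<bullet> conjugate (k \<cdot>\<^sub>v v)"
    by (simp only: conjA[symmetric] Av)
  also have "\<dots> = cnj k * (v \<bullet>c v)"
    using v by (simp add: conjugate_smult_vec)
  finally have "k = cnj k" using v by simp
  then show ?thesis by (metis Reals_cnj_iff)
qed

text \<open>Over the complex numbers the characteristic polynomial factors completely, and its roots
  are eigenvalues, hence real. The embedding of real into complex polynomials is injective, which
  brings the factorization back.\<close>

lemma char_poly_real_symmetric_splits:
  fixes A :: "real mat"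
  assumes A: "A \<in> carrier_mat n n" and sym: "A\<^sup>T = A"
  obtains es where "char_poly A = (\<Prod>e\<leftarrow>es. [:- e, 1:])" "length es = n"
proof -
  interpret map_poly_inj_idom_hom complex_of_real ..
  let ?A = "map_mat complex_of_real A"
  have cA: "?A \<in> carrier_mat n n" using A by auto
  from char_poly_factorized[OF cA] obtain as
    where as: "char_poly ?A = (\<Prod>a\<leftarrow>as. [:- a, 1:])" and len: "length as = n" by auto
  have "a \<in> \<real>" if "a \<in> set as" for a
  proof (rule eigenvalue_real_symmetric_is_real[OF A sym])
    show "eigenvalue ?A a"
      unfolding eigenvalue_root_char_poly[OF cA] as poly_prod_list
      using that by force
  qed
  then have as_eq: "as = map (complex_of_real \<circ> Re) as"
    by (induction as) auto
  have "map_poly complex_of_real (char_poly A) = (\<Prod>a\<leftarrow>as. [:- a, 1:])"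
    using of_real_hom.char_poly_hom[OF A] as by metis
  also have "\<dots> = map_poly complex_of_real (\<Prod>e\<leftarrow>map Re as. [:- e, 1:])"
    by (subst as_eq) (simp add: hom_prod_list o_def)
  finally have "char_poly A = (\<Prod>e\<leftarrow>map Re as. [:- e, 1:])"
    by simp
  then show thesis using that[of "map Re as"] len by simp
qed

text \<open>A Schur decomposition yields a similar upper triangular matrix with diagonal
  \<open>es\<close>. In the trace of its square, the product of the entries at (i, j) and (j, i)
  survives only for i = j, since otherwise one of them lies below the diagonal.\<close>

lemma trace_char_poly_roots:
  fixes A :: "real mat"
  assumes A: "A \<in> carrier_mat n n" and es: "char_poly A = (\<Prod>e\<leftarrow>es. [:- e, 1:])"
  shows "sum_list es = mat_trace A" "(\<Sum>e\<leftarrow>es. e\<^sup>2) = mat_trace (A * A)"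
proof -
  obtain B P Q where "schur_decomposition A es = (B, P, Q)"
    by (cases "schur_decomposition A es") auto
  from schur_decomposition[OF A es this] have wit: "similar_mat_wit A B P Q"
    and ut: "upper_triangular B" and diag: "diag_mat B = es" by auto
  from wit have sim: "similar_mat A B" by (auto simp: similar_mat_def)
  have B: "B \<in> carrier_mat n n" using wit A by (auto simp: similar_mat_wit_def Let_def)
  have es_eq: "es = map (\<lambda>i. B $$ (i, i)) [0..<n]"
    using diag B by (simp add: diag_mat_def)
  show "sum_list es = mat_trace A"
    unfolding mat_trace_similar[OF sim] es_eq using B
    by (simp add: mat_trace_def sum_list_sum_nth atLeast0LessThan)
  have "B $$ (i, j) * B $$ (j, i) = (if j = i then (B $$ (i, i))\<^sup>2 else 0)"
    if "i < n" "j < n" for i j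
    using ut B that by (cases i j rule: linorder_cases)
      (auto simp: upper_triangular_def power2_eq_square)
  then have "mat_trace (B * B) = (\<Sum>i<n. (B $$ (i, i))\<^sup>2)"
    unfolding mat_trace_mult[OF B B] by (intro sum.cong) simp_all
  then show "(\<Sum>e\<leftarrow>es. e\<^sup>2) = mat_trace (A * A)"
    unfolding mat_trace_similar[OF similar_mat_square[OF sim]] es_eq
    by (simp add: sum_list_sum_nth atLeast0LessThan)
qed

lemma proots_prod_list_linear:
  fixes es :: "'a :: idom list"
  shows "proots (\<Prod>e\<leftarrow>es. [:- e, 1:]) = mset es"
proof (induction es)
  case (Cons e es)
  have "(\<Prod>e\<leftarrow>es. [:- e, 1:]) \<noteq> 0" by auto
  with Cons show ?case by (simp add: proots_mult del: mult_pCons_left)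
qed simp

text \<open>Because the characteristic polynomial splits over the reals, collecting its real roots
  with multiplicity loses nothing, so positions in the sorted list number the whole
  spectrum.\<close>

lemma sorted_eigenvalues_real_symmetric:
  fixes A :: "real mat"
  assumes A: "A \<in> carrier_mat n n" and sym: "A\<^sup>T = A"
  shows "length (sorted_eigenvalues A) = n"
    and "char_poly A = (\<Prod>e\<leftarrow>sorted_eigenvalues A. [:- e, 1:])"
proof -
  obtain es where es: "char_poly A = (\<Prod>e\<leftarrow>es. [:- e, 1:])" "length es = n"
    using char_poly_real_symmetric_splits[OF A sym] .
  have mset: "mset (sorted_eigenvalues A) = mset es"
    by (simp add: sorted_eigenvalues_def es(1) proots_prod_list_linear)
  then show "length (sorted_eigenvalues A) = n" using es(2) by (metis size_mset)
  have "(\<Prod>e\<leftarrow>sorted_eigenvalues A. [:- e, 1:]) = (\<Prod>e\<leftarrow>es. [:- e, 1:])"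
    using mset by (metis mset_map prod_mset_prod_list)
  with es(1) show "char_poly A = (\<Prod>e\<leftarrow>sorted_eigenvalues A. [:- e, 1:])" by simp
qed

section \<open>From sums of squares to a projection identity\<close>

lemma sorted_tail_constant_iff_sum_squares:
  fixes xs :: "real list" and n :: nat
  defines "c \<equiv> real n / (real n - 1)"
  assumes "sorted xs" and len: "length xs = n" and n: "n \<ge> 2"
    and zero: "0 \<in> set xs" and sum: "sum_list xs = real n"
  shows "xs ! 1 = c \<and> xs ! (n - 1) = c \<longleftrightarrow> (\<Sum>x\<leftarrow>xs. x\<^sup>2) = (real n - 1) * c\<^sup>2"
proof
  have c: "(real n - 1) * c = real n" "c > 0" using n by (auto simp: c_def)
  have tail: "(\<Sum>y\<leftarrow>replicate (n - 1) c. f y) = (real n - 1) * f c" for f :: "real \<Rightarrow> real"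
    using n by (simp add: sum_list_replicate)
  {
    assume ends: "xs ! 1 = c \<and> xs ! (n - 1) = c"
    obtain x ys where xs: "xs = x # ys" using len n by (cases xs) auto
    have "ys = replicate (n - 1) c"
    proof (rule nth_equalityI)
      fix i assume i: "i < length ys"
      have "xs ! 1 \<le> xs ! Suc i" "xs ! Suc i \<le> xs ! (n - 1)"
        using i len xs by (intro sorted_nth_mono[OF \<open>sorted xs\<close>]; simp)+
      then show "ys ! i = replicate (n - 1) c ! i"
        using ends xs i len by simp
    qed (use xs len in simp)
    \<comment> \<open>The tail already sums to \<open>(n - 1) * c = n\<close>, which forces the
      first entry to be 0.\<close>
    with xs sum c tail[of "\<lambda>y. y"] tail[of "\<lambda>y. y\<^sup>2"]
    show "(\<Sum>x\<leftarrow>xs. x\<^sup>2) = (real n - 1) * c\<^sup>2" by simp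
  }
  assume sq: "(\<Sum>x\<leftarrow>xs. x\<^sup>2) = (real n - 1) * c\<^sup>2"
  \<comment> \<open>Negative entries are not excluded at this point, so 0 need not come first; one
    occurrence is removed wherever it stands.\<close>
  define ys where "ys = remove1 0 xs"
  have perm: "mset xs = mset (0 # ys)" using zero by (simp add: ys_def)
  have len_ys: "length ys = n - 1" using zero len by (simp add: ys_def length_remove1)
  have sum_map: "(\<Sum>y\<leftarrow>ys. f y) = (\<Sum>x\<leftarrow>xs. f x)" if "f 0 = 0" for f :: "real \<Rightarrow> real"
  proof -
    have "(\<Sum>x\<leftarrow>xs. f x) = (\<Sum>x\<leftarrow>0 # ys. f x)"
      using perm by (metis mset_map sum_mset_sum_list)
    with that show ?thesis by simp
  qed
  \<comment> \<open>The remaining entries have mean \<open>c\<close>; their squared deviations from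
    it add up to 0.\<close>
  have "(\<Sum>y\<leftarrow>ys. (y - c)\<^sup>2) = (\<Sum>y\<leftarrow>ys. y\<^sup>2 - 2 * c * y + c\<^sup>2)"
    by (intro arg_cong[where f = sum_list] map_cong) (auto simp: power2_eq_square algebra_simps)
  also have "\<dots> = (\<Sum>y\<leftarrow>ys. y\<^sup>2) - 2 * c * (\<Sum>y\<leftarrow>ys. y) + real (length ys) * c\<^sup>2"
    by (induction ys) (auto simp: algebra_simps)
  also have "\<dots> = 2 * c * ((real n - 1) * c - real n)"
    using sum_map[of "\<lambda>y. y\<^sup>2"] sum_map[of "\<lambda>y. y"] sq sum len_ys n
    by (simp add: power2_eq_square algebra_simps)
  finally have "(\<Sum>y\<leftarrow>ys. (y - c)\<^sup>2) = 0" using c by simp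
  then have "\<forall>y\<in>set ys. y = c"
    by (subst (asm) sum_list_nonneg_eq_0_iff) auto
  then have "ys = replicate (n - 1) c" using len_ys by (metis replicate_eqI)
  with perm have "mset xs = mset (0 # replicate (n - 1) c)" by simp
  \<comment> \<open>A sorted list is determined by its multiset, and \<open>c > 0\<close> puts the 0
    in front.\<close>
  then have "xs = 0 # replicate (n - 1) c"
    using \<open>sorted xs\<close> c(2)
    by (intro properties_for_sort[symmetric, THEN trans[OF _ sorted_sort_id]]) auto
  then show "xs ! 1 = c \<and> xs ! (n - 1) = c" using n by (auto simp: nth_Cons')
qed

lemma eigenvalues_eq_iff_scaled_projection:
  fixes A :: "real mat" and q :: "nat \<Rightarrow> real" and n :: nat
  defines "c \<equiv> real n / (real n - 1)"
  assumes A: "A \<in> carrier_mat n n" and sym: "A\<^sup>T = A" and n: "n \<ge> 2"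
    and trace: "mat_trace A = real n"
    and kernel: "\<And>i. i < n \<Longrightarrow> (\<Sum>j<n. A $$ (i, j) * q j) = 0"
    and unit: "(\<Sum>i<n. (q i)\<^sup>2) = 1"
  shows "nth_eigenvalue A 2 = c \<and> nth_eigenvalue A n = c \<longleftrightarrow>
    (\<forall>i<n. \<forall>j<n. A $$ (i, j) = c * (of_bool (i = j) - q i * q j))"
proof -
  \<comment> \<open>\<open>?P\<close> gives the entries of the orthogonal projection onto the
    complement of \<open>q\<close>.\<close>
  let ?es = "sorted_eigenvalues A" and ?P = "\<lambda>i j. of_bool (i = j) - q i * q j"
  have c: "(real n - 1) * c = real n" using n by (auto simp: c_def)
  note es = sorted_eigenvalues_real_symmetric[OF A sym]
  have "vec n q \<noteq> 0\<^sub>v n"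
  proof
    assume "vec n q = 0\<^sub>v n"
    then have "q i = 0" if "i < n" for i using that by (metis index_vec index_zero_vec(1))
    with unit show False by simp
  qed
  moreover have "A *\<^sub>v vec n q = 0 \<cdot>\<^sub>v vec n q"
    using A kernel by (intro eq_vecI) (auto simp: scalar_prod_def atLeast0LessThan)
  ultimately have "eigenvalue A 0"
    using A unfolding eigenvalue_def eigenvector_def by (intro exI[of _ "vec n q"]) auto
  then have zero: "0 \<in> set ?es"
    unfolding eigenvalue_root_char_poly[OF A] es(2) poly_prod_list by auto
  have symm: "A $$ (j, i) = A $$ (i, j)" if "i < n" "j < n" for i j
    using that A sym by (metis carrier_matD index_transpose_mat(1))
  \<comment> \<open>Eigenvalues are numbered from 1 and list positions from 0, so numbers 2 and
    \<open>n\<close> are positions 1 and \<open>n - 1\<close>.\<close>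
  have "nth_eigenvalue A 2 = c \<and> nth_eigenvalue A n = c \<longleftrightarrow> (\<Sum>e\<leftarrow>?es. e\<^sup>2) = (real n - 1) * c\<^sup>2"
    unfolding c_def nth_eigenvalue_def
    using sorted_tail_constant_iff_sum_squares[of ?es n] es(1) n zero
      trace_char_poly_roots(1)[OF A es(2)] trace
    by (simp add: sorted_eigenvalues_def)
  also have "(\<Sum>e\<leftarrow>?es. e\<^sup>2) = (\<Sum>i<n. \<Sum>j<n. (A $$ (i, j))\<^sup>2)"
    unfolding trace_char_poly_roots(2)[OF A es(2)] mat_trace_mult[OF A A]
    by (intro sum.cong refl) (simp add: symm power2_eq_square)
  also have "\<dots> = (real n - 1) * c\<^sup>2 \<longleftrightarrow> (\<Sum>i<n. \<Sum>j<n. (A $$ (i, j) - c * ?P i j)\<^sup>2) = 0"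
  proof -
    \<comment> \<open>As \<open>q\<close> lies in the kernel, multiplying \<open>A\<close> by the
      projection changes nothing, so this Frobenius inner product is the trace of
      \<open>A\<close>.\<close>
    have AP: "(\<Sum>i<n. \<Sum>j<n. A $$ (i, j) * ?P i j) = real n"
    proof -
      have "(\<Sum>j<n. A $$ (i, j) * ?P i j) = A $$ (i, i)" if "i < n" for i
      proof -
        have "(\<Sum>j<n. A $$ (i, j) * ?P i j) =
            (\<Sum>j<n. A $$ (i, j) * of_bool (i = j)) - q i * (\<Sum>j<n. A $$ (i, j) * q j)"
          by (simp add: algebra_simps sum_subtractf sum_distrib_left)
        then show ?thesis using that kernel by (simp add: of_bool_def if_distrib cong: if_cong)
      qed
      then show ?thesis using trace A by (simp add: mat_trace_def)
    qed
    \<comment> \<open>The squared Frobenius norm of an orthogonal projection is its rank; row i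
      contributes \<open>1 - (q i)\<^sup>2\<close>.\<close>
    have PP: "(\<Sum>i<n. \<Sum>j<n. (?P i j)\<^sup>2) = real n - 1"
    proof -
      have "(\<Sum>j<n. (?P i j)\<^sup>2) = 1 - (q i)\<^sup>2" if "i < n" for i
      proof -
        have "(\<Sum>j<n. (?P i j)\<^sup>2) =
            (\<Sum>j<n. if i = j then 1 - 2 * (q i)\<^sup>2 else 0) + (\<Sum>j<n. (q i)\<^sup>2 * (q j)\<^sup>2)"
          unfolding sum.distrib[symmetric]
          by (intro sum.cong) (auto simp: power2_eq_square algebra_simps)
        also have "\<dots> = 1 - 2 * (q i)\<^sup>2 + (q i)\<^sup>2"
          using that unit by (simp flip: sum_distrib_left)
        finally show ?thesis by simp
      qed
      then show ?thesis using unit by (simp add: sum_subtractf)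
    qed
    have "(\<Sum>i<n. \<Sum>j<n. (A $$ (i, j) - c * ?P i j)\<^sup>2) =
        (\<Sum>i<n. \<Sum>j<n. (A $$ (i, j))\<^sup>2 - 2 * c * (A $$ (i, j) * ?P i j) + c\<^sup>2 * (?P i j)\<^sup>2)"
      by (intro sum.cong refl) (simp only: power2_diff power_mult_distrib mult_ac)
    also have "\<dots> = (\<Sum>i<n. \<Sum>j<n. (A $$ (i, j))\<^sup>2) -
        2 * c * (\<Sum>i<n. \<Sum>j<n. A $$ (i, j) * ?P i j) + c\<^sup>2 * (\<Sum>i<n. \<Sum>j<n. (?P i j)\<^sup>2)"
      by (simp only: sum.distrib sum_subtractf sum_distrib_left)
    also have "\<dots> = (\<Sum>i<n. \<Sum>j<n. (A $$ (i, j))\<^sup>2) - (real n - 1) * c\<^sup>2"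
    proof -
      \<comment> \<open>This merges the cross term \<open>- 2 * c * n\<close> and the projection
        term \<open>c\<^sup>2 * (n - 1)\<close> into \<open>- (n - 1) * c\<^sup>2\<close>.\<close>
      have "c * real n = (real n - 1) * c\<^sup>2"
        using arg_cong[OF c, of "(*) c"] by (simp add: power2_eq_square algebra_simps)
      then show ?thesis unfolding AP PP by (simp add: algebra_simps)
    qed
    finally show ?thesis by simp
  qed
  also have "\<dots> \<longleftrightarrow> (\<forall>i<n. \<forall>j<n. A $$ (i, j) = c * ?P i j)"
    by (auto simp: sum_nonneg_eq_0_iff sum_nonneg)
  finally show ?thesis .
qed

section \<open>Normalized Laplacians of symmetric weights\<close>

text \<open>Separates the linear algebra from the graph: the distances enter only as a symmetric
  real weight with zero diagonal and positive row sums.\<close>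

lemma normalized_laplacian_eigenvalues_eq_iff:
  fixes d :: "nat \<Rightarrow> nat \<Rightarrow> real" and t :: "nat \<Rightarrow> real" and n :: nat
  defines "c \<equiv> real n / (real n - 1)"
    and "A \<equiv> mat n n (\<lambda>(i, j). of_bool (i = j) - d i j / (sqrt (t i) * sqrt (t j)))"
  assumes n: "n \<ge> 2" and d_sym: "\<And>i j. i < n \<Longrightarrow> j < n \<Longrightarrow> d i j = d j i"
    and d_diag: "\<And>i. i < n \<Longrightarrow> d i i = 0"
    and t: "\<And>i. i < n \<Longrightarrow> t i = (\<Sum>j<n. d i j)" and t_pos: "\<And>i. i < n \<Longrightarrow> t i > 0"
  shows "nth_eigenvalue A 2 = c \<and> nth_eigenvalue A n = c \<longleftrightarrow>
    (\<exists>a. \<forall>i<n. \<forall>j<n. i \<noteq> j \<longrightarrow> d i j = a)"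
proof -
  define W where "W = (\<Sum>i<n. t i)"
  \<comment> \<open>The square roots of the row sums span a line in the kernel; \<open>W\<close> is
    the squared norm of that vector.\<close>
  define q where "q i = sqrt (t i) / sqrt W" for i
  have W: "W > 0" unfolding W_def using n t_pos by (intro sum_pos) (auto simp: lessThan_empty_iff)
  have c: "c * (1 - 1 / real n) = 1" "c \<noteq> 0" using n by (auto simp: c_def field_simps)
  have A: "A \<in> carrier_mat n n" by (simp add: A_def)
  have A_ij: "A $$ (i, j) = of_bool (i = j) - d i j / (sqrt (t i) * sqrt (t j))"
    if "i < n" "j < n" for i j using that by (simp add: A_def)
  have qq: "q i * q j = sqrt (t i) * sqrt (t j) / W" for i j
    using W by (simp add: q_def)
  have iff: "nth_eigenvalue A 2 = c \<and> nth_eigenvalue A n = c \<longleftrightarrow>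
    (\<forall>i<n. \<forall>j<n. A $$ (i, j) = c * (of_bool (i = j) - q i * q j))"
    unfolding c_def
  proof (rule eigenvalues_eq_iff_scaled_projection[OF A _ n])
    show "A\<^sup>T = A" by (intro eq_matI) (auto simp: A_def d_sym mult.commute)
    show "mat_trace A = real n" using d_diag by (simp add: mat_trace_def A_def)
    show "(\<Sum>i<n. (q i)\<^sup>2) = 1"
      using W t_pos by (simp add: q_def power_divide less_imp_le W_def flip: sum_divide_distrib)
    fix i assume i: "i < n"
    \<comment> \<open>The \<open>sqrt (t j)\<close> in \<open>q j\<close> cancels the one in the
      denominator, leaving the row sum of \<open>d\<close>, which is \<open>t i\<close>.\<close>
    have "(\<Sum>j<n. A $$ (i, j) * q j) =
        (\<Sum>j<n. (if i = j then sqrt (t i) / sqrt W else 0) - d i j / (sqrt (t i) * sqrt W))"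
      using i t_pos by (intro sum.cong)
        (auto simp: A_ij q_def d_diag field_simps less_imp_neq[symmetric])
    also have "\<dots> = sqrt (t i) / sqrt W - t i / (sqrt (t i) * sqrt W)"
      using i t by (simp add: sum_subtractf flip: sum_divide_distrib)
    also have "\<dots> = 0"
      using t_pos[OF i] W by (simp add: field_simps)
    finally show "(\<Sum>j<n. A $$ (i, j) * q j) = 0" .
  qed
  show ?thesis unfolding iff
  proof
    assume eq: "\<forall>i<n. \<forall>j<n. A $$ (i, j) = c * (of_bool (i = j) - q i * q j)"
    have ti: "t i = W / real n" if "i < n" for i
    proof -
      \<comment> \<open>Both sides equal 1: the left by the diagonal entry of the identity, the
        right by the choice of \<open>c\<close>.\<close>
      have "c * (1 - t i / W) = c * (1 - 1 / real n)"
        using eq[rule_format, OF that that] t_pos[OF that] unfolding c(1)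
        by (simp add: A_ij that d_diag qq)
      then have "t i / W = 1 / real n" using c(2) by simp
      then show ?thesis using W by (simp add: field_simps)
    qed
    \<comment> \<open>The off-diagonal entry of the identity, solved for \<open>d i j\<close> with
      both row sums equal to \<open>W / n\<close>.\<close>
    have "d i j = c * (W / real n)\<^sup>2 / W" if "i < n" "j < n" "i \<noteq> j" for i j
    proof -
      have "d i j / (W / real n) = c * (W / real n) / W"
        using eq[rule_format, OF that(1,2)] that W by (simp add: A_ij qq ti)
      then show ?thesis using W n by (simp add: field_simps power2_eq_square)
    qed
    then show "\<exists>a. \<forall>i<n. \<forall>j<n. i \<noteq> j \<longrightarrow> d i j = a" by blast
  next
    assume "\<exists>a. \<forall>i<n. \<forall>j<n. i \<noteq> j \<longrightarrow> d i j = a"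
    then obtain a where a: "\<And>i j. i < n \<Longrightarrow> j < n \<Longrightarrow> i \<noteq> j \<Longrightarrow> d i j = a" by blast
    have ti: "t i = (real n - 1) * a" if "i < n" for i
    proof -
      have "t i = (\<Sum>j\<in>{..<n} - {i}. d i j)"
        using t d_diag that by (simp add: sum.remove[of _ i])
      also have "\<dots> = (real n - 1) * a" using a that n by (simp add: of_nat_diff)
      finally show ?thesis .
    qed
    have a_pos: "a > 0" using ti[of 0] t_pos[of 0] n by (simp add: zero_less_mult_iff)
    have W_eq: "W = real n * ((real n - 1) * a)" by (simp add: W_def ti)
    show "\<forall>i<n. \<forall>j<n. A $$ (i, j) = c * (of_bool (i = j) - q i * q j)"
    proof (intro allI impI)
      fix i j assume ij: "i < n" "j < n"
      have pos: "(real n - 1) * a > 0" using a_pos n by simp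
      have st: "sqrt (t i) * sqrt (t j) = (real n - 1) * a"
        using ij pos by (simp add: ti)
      show "A $$ (i, j) = c * (of_bool (i = j) - q i * q j)"
      proof (cases "i = j")
        case True
        then show ?thesis
          using ij n a_pos c(1) d_diag unfolding A_ij[OF ij] qq st W_eq by simp
      next
        case False
        then have "A $$ (i, j) = - a / ((real n - 1) * a)"
          using ij a unfolding A_ij[OF ij] st by simp
        also have "\<dots> = c * (0 - 1 / real n)"
          using n a_pos by (simp add: c_def)
        also have "\<dots> = c * (of_bool (i = j) - q i * q j)"
          using False n a_pos unfolding qq st W_eq by simp
        finally show ?thesis .
      qed
    qed
  qed
qed

section \<open>Graph distance and completeness\<close>

text \<open>Going back uses other arcs: for each arc of the walk, symmetry supplies one in the
  opposite direction, so the reversed walk is obtained only existentially.\<close>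

lemma (in sym_digraph) awalk_reverse:
  assumes "awalk u p v"
  shows "\<exists>p'. awalk v p' u \<and> length p' = length p"
  using assms
proof (induction p arbitrary: u)
  case Nil
  then show ?case by (auto simp: awalk_Nil_iff)
next
  case (Cons e p)
  then obtain p' where p': "awalk v p' (head G e)" "length p' = length p"
    by (auto simp: awalk_Cons_iff)
  from Cons.prems have e: "e \<in> arcs G" "tail G e = u" by (auto simp: awalk_Cons_iff)
  with sym_arcs obtain e' where e': "e' \<in> arcs G" "tail G e' = head G e" "head G e' = u"
    unfolding symmetric_conv by metis
  then have "awalk (head G e) [e'] u" by (auto simp: awalk_Cons_iff awalk_Nil_iff)
  with p' show ?case by (intro exI[of _ "p' @ [e']"]) (auto intro: awalk_appendI)
qed

lemma (in sym_digraph) gdist_commute: "gdist G u v = gdist G v u"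
proof -
  have "(\<exists>p. awalk u p v \<and> length p = k) = (\<exists>p. awalk v p u \<and> length p = k)" for k
    using awalk_reverse by metis
  then show ?thesis unfolding gdist_def by presburger
qed

text \<open>Reachability makes the set of walk lengths nonempty, so the \<open>LEAST\<close> in
  \<open>gdist\<close> is attained rather than unspecified.\<close>

lemma (in wf_digraph) gdist_awalk:
  assumes "u \<rightarrow>\<^sup>* v"
  shows "\<exists>p. awalk u p v \<and> length p = gdist G u v"
proof -
  have "\<exists>k p. awalk u p v \<and> length p = k" using assms by (simp add: reachable_awalk)
  then show ?thesis unfolding gdist_def by (rule LeastI_ex)
qed

lemma (in wf_digraph) gdist_eq_0_iff:
  assumes "u \<rightarrow>\<^sup>* v"
  shows "gdist G u v = 0 \<longleftrightarrow> u = v"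
proof
  assume "gdist G u v = 0"
  with gdist_awalk[OF assms] show "u = v" by (auto simp: awalk_Nil_iff)
next
  assume "u = v"
  with assms show "gdist G u v = 0"
    unfolding gdist_def by (intro Least_eq_0) (auto simp: awalk_Nil_iff reachable_in_verts)
qed

lemma (in wf_digraph) gdist_eq_1_iff:
  assumes "u \<rightarrow>\<^sup>* v" "u \<noteq> v"
  shows "gdist G u v = 1 \<longleftrightarrow> (u, v) \<in> arcs_ends G"
proof
  assume "gdist G u v = 1"
  with gdist_awalk[OF assms(1)] obtain e where "awalk u [e] v" by (auto simp: length_Suc_conv)
  then show "(u, v) \<in> arcs_ends G" by (auto simp: awalk_simps arcs_ends_conv)
next
  assume "(u, v) \<in> arcs_ends G"
  then obtain e where "e \<in> arcs G" "tail G e = u" "head G e = v"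
    by (auto simp: arcs_ends_conv)
  then have "awalk u [e] v" by (auto simp: awalk_simps)
  then have "gdist G u v \<le> 1" unfolding gdist_def by (intro Least_le exI[of _ "[e]"]) auto
  with gdist_eq_0_iff[OF assms(1)] assms(2) show "gdist G u v = 1" by linarith
qed

text \<open>\<open>connected\<close> refers to the symmetric closure. In a symmetric digraph that
  closure has the same \<open>arcs_ends\<close>, hence the same reachability.\<close>

lemma (in sym_digraph) connected_imp_strongly_connected:
  assumes "connected G"
  shows "strongly_connected G"
proof -
  have "arcs_ends (with_proj (mk_symmetric G)) = arcs_ends G"
    using sym_arcs by (auto simp: parcs_mk_symmetric symmetric_def sym_def
        intro: dominatesI[unfolded arc_to_ends_def])
  with assms show ?thesis
    by (simp add: connected_def strongly_connected_def reachable_def)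
qed

text \<open>A walk between two distinct vertices contains an arc, and the ends of an arc are at
  distance 1. A constant distance is therefore 1, which means that all distinct vertices are
  adjacent.\<close>

lemma complete_iff_gdist_constant:
  assumes "graph G" and "Digraph_Component.connected G" and "card (verts G) \<ge> 2"
  shows "complete_digraph (card (verts G)) G \<longleftrightarrow>
    (\<exists>a. \<forall>u\<in>verts G. \<forall>v\<in>verts G. u \<noteq> v \<longrightarrow> gdist G u v = a)"
proof -
  interpret graph G by fact
  have reach: "u \<rightarrow>\<^sup>*\<^bsub>G\<^esub> v" if "u \<in> verts G" "v \<in> verts G" for u v
    using connected_imp_strongly_connected[OF assms(2)] that by (auto simp: strongly_connected_def)
  have no_loop: "u \<noteq> v" if "(u, v) \<in> arcs_ends G" for u v
    using that no_loops by (auto simp: arcs_ends_conv)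
  have ends: "u \<in> verts G \<and> v \<in> verts G" if "(u, v) \<in> arcs_ends G" for u v
    using that by (auto simp: arcs_ends_conv)
  have dist1: "gdist G u v = 1 \<longleftrightarrow> (u, v) \<in> arcs_ends G"
    if "u \<in> verts G" "v \<in> verts G" "u \<noteq> v" for u v
    using that reach by (intro gdist_eq_1_iff)
  obtain u v where uv: "u \<in> verts G" "v \<in> verts G" "u \<noteq> v"
    using assms(3) by (metis card_le_Suc0_iff_eq finite_verts not_less_eq_eq numeral_2_eq_2)
  have "\<not> arcs_ends G = {}"
  proof
    assume "arcs_ends G = {}"
    with reach[OF uv(1,2)] uv(3) show False
      by (auto simp: reachable_awalk arcs_ends_def awalk_def elim: cas.elims)
  qed
  then obtain x y where xy: "(x, y) \<in> arcs_ends G" by auto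
  show ?thesis
  proof
    assume "complete_digraph (card (verts G)) G"
    then show "\<exists>a. \<forall>u\<in>verts G. \<forall>v\<in>verts G. u \<noteq> v \<longrightarrow> gdist G u v = a"
      by (intro exI[of _ 1]) (auto simp: dist1[unfolded One_nat_def] complete_digraph_def)
  next
    assume "\<exists>a. \<forall>u\<in>verts G. \<forall>v\<in>verts G. u \<noteq> v \<longrightarrow> gdist G u v = a"
    then obtain a where a: "\<And>u v. u \<in> verts G \<Longrightarrow> v \<in> verts G \<Longrightarrow> u \<noteq> v \<Longrightarrow> gdist G u v = a"
      by blast
    have "a = 1"
      using a[of x y] dist1[of x y] ends[OF xy] no_loop[OF xy] xy by simp
    with a dist1 have "(u, v) \<in> arcs_ends G" if "u \<in> verts G" "v \<in> verts G" "u \<noteq> v" for u v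
      using that by metis
    then show "complete_digraph (card (verts G)) G"
      unfolding complete_digraph_def using assms(1) ends no_loop by blast
  qed
qed

section \<open>Application to the normalized distance Laplacian\<close>

text \<open>Positivity lets the scaling turn \<open>t / (sqrt t * sqrt t)\<close> into 1. The
  distance term stays on the diagonal here; it vanishes once the distance from a vertex to itself is
  known to be 0.\<close>

lemma normalized_distance_laplacian_eq:
  assumes t: "\<And>i. i < length vs \<Longrightarrow> transmission G (vs ! i) > 0"
  shows "normalized_distance_laplacian G vs = mat (length vs) (length vs) (\<lambda>(i, j).
    of_bool (i = j) - real (gdist G (vs ! i) (vs ! j)) /
      (sqrt (real (transmission G (vs ! i))) * sqrt (real (transmission G (vs ! j)))))"
proof -
  let ?n = "length vs"
  have D: "transmission_matrix G vs - distance_matrix G vs \<in> carrier_mat ?n ?n"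
    by (simp add: transmission_matrix_def distance_matrix_def minus_carrier_mat)
  show ?thesis
    unfolding normalized_distance_laplacian_def transmission_matrix_inv_sqrt_def
      mat_diag_mult_left[OF D] mat_diag_mult_right[OF mat_carrier]
    by (intro eq_matI) (auto simp: transmission_matrix_def distance_matrix_def mat_diag_def
        diff_divide_distrib mult.commute dest: t)
qed

theorem theorem3p1:
  fixes G :: "('a, 'b) pre_digraph" and vs :: "'a list" and n :: nat
  assumes "graph G" and "Digraph_Component.connected G"
    and "card (verts G) = n" and "n \<ge> 2"
    and "distinct vs" and "set vs = verts G"
  shows "(nth_eigenvalue (normalized_distance_laplacian G vs) 2 = real n / (real n - 1) \<and>
          nth_eigenvalue (normalized_distance_laplacian G vs) n = real n / (real n - 1))
         \<longleftrightarrow> complete_digraph n G"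
proof -
  interpret graph G by fact
  have len: "length vs = n"
    using assms(3,5,6) distinct_card by fastforce
  have bij: "bij_betw (\<lambda>i. vs ! i) {..<n} (verts G)"
    using bij_betw_nth[OF assms(5) _ assms(6)[symmetric]] len by blast
  have in_verts: "vs ! i \<in> verts G" if "i < n" for i
    using that len assms(6) nth_mem by blast
  have neq: "vs ! i \<noteq> vs ! j" if "i < n" "j < n" "i \<noteq> j" for i j
    using that len assms(5) nth_eq_iff_index_eq by blast
  have reach: "u \<rightarrow>\<^sup>*\<^bsub>G\<^esub> v" if "u \<in> verts G" "v \<in> verts G" for u v
    using connected_imp_strongly_connected[OF assms(2)] that by (auto simp: strongly_connected_def)
  define d where "d i j = real (gdist G (vs ! i) (vs ! j))" for i j
  define t where "t i = real (transmission G (vs ! i))" for i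
  have d_diag: "d i i = 0" if "i < n" for i
    using that in_verts by (simp add: d_def gdist_eq_0_iff)
  have d_pos: "d i j > 0" if "i < n" "j < n" "i \<noteq> j" for i j
    using gdist_eq_0_iff[OF reach[OF in_verts in_verts], of i j] that neq by (simp add: d_def)
  have t_eq: "t i = (\<Sum>j<n. d i j)" if "i < n" for i
  proof -
    \<comment> \<open>The vertex left out in \<open>transmission\<close> may be put back, as its
      distance to itself is 0.\<close>
    have "t i = (\<Sum>v\<in>verts G. real (gdist G (vs ! i) v))"
      using in_verts[OF that] by (simp add: t_def transmission_def sum.remove gdist_eq_0_iff)
    also have "\<dots> = (\<Sum>j<n. d i j)"
      unfolding d_def by (rule sum.reindex_bij_betw[OF bij, symmetric])
    finally show ?thesis .
  qed
  have t_pos: "t i > 0" if i: "i < n" for i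
  proof -
    obtain j where j: "j < n" "i \<noteq> j" using assms(4) that
      by (metis One_nat_def Suc_1 Suc_le_lessD less_Suc_eq_0_disj not_less_eq)
    show ?thesis unfolding t_eq[OF i]
      by (rule sum_pos2[of _ j]) (use j d_pos[OF i j] in \<open>auto simp: d_def\<close>)
  qed
  have L: "normalized_distance_laplacian G vs =
      mat n n (\<lambda>(i, j). of_bool (i = j) - d i j / (sqrt (t i) * sqrt (t j)))"
    using normalized_distance_laplacian_eq[of vs G] t_pos len by (simp add: d_def t_def)
  have d_sym: "d i j = d j i" for i j by (simp add: d_def gdist_commute)
  have "(nth_eigenvalue (normalized_distance_laplacian G vs) 2 = real n / (real n - 1) \<and>
      nth_eigenvalue (normalized_distance_laplacian G vs) n = real n / (real n - 1)) \<longleftrightarrow>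
      (\<exists>a. \<forall>i<n. \<forall>j<n. i \<noteq> j \<longrightarrow> d i j = a)"
    unfolding L using assms(4) d_diag t_eq t_pos d_sym
    by (intro normalized_laplacian_eigenvalues_eq_iff)
  also have "\<dots> \<longleftrightarrow> (\<exists>a. \<forall>u\<in>verts G. \<forall>v\<in>verts G. u \<noteq> v \<longrightarrow> gdist G u v = a)"
  proof
    assume "\<exists>a. \<forall>i<n. \<forall>j<n. i \<noteq> j \<longrightarrow> d i j = a"
    then obtain a where a: "\<And>i j. i < n \<Longrightarrow> j < n \<Longrightarrow> i \<noteq> j \<Longrightarrow> d i j = a" by blast
    \<comment> \<open>The common value \<open>a\<close> is real while \<open>gdist\<close> is
      natural; as \<open>a\<close> equals a distance, taking the floor recovers it exactly.\<close>
    have "gdist G u v = nat \<lfloor>a\<rfloor>" if uv: "u \<in> verts G" "v \<in> verts G" "u \<noteq> v" for u v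
    proof -
      obtain i j where ij: "i < n" "j < n" "u = vs ! i" "v = vs ! j"
        using uv(1,2) len unfolding assms(6)[symmetric] in_set_conv_nth by blast
      with uv(3) have "d i j = a" by (intro a) auto
      with ij show ?thesis by (auto simp: d_def)
    qed
    then show "\<exists>a. \<forall>u\<in>verts G. \<forall>v\<in>verts G. u \<noteq> v \<longrightarrow> gdist G u v = a" by blast
  next
    assume "\<exists>a. \<forall>u\<in>verts G. \<forall>v\<in>verts G. u \<noteq> v \<longrightarrow> gdist G u v = a"
    then show "\<exists>a. \<forall>i<n. \<forall>j<n. i \<noteq> j \<longrightarrow> d i j = a"
      unfolding d_def using in_verts neq by metis
  qed
  also have "\<dots> \<longleftrightarrow> complete_digraph n G"
    using complete_iff_gdist_constant[OF assms(1,2)] assms(3,4) by simp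
  finally show ?thesis .
qed

end
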